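(* Let $\rho(x,t)\in\{-1,+1\}$ be arbitrarily defined for all integers $t\ge 0$ and $x$ with $x\sim t$. Then there exists an even initial configuration (of chips and arrows) of the Propp machine on $\mathbb{Z}$ that results in a game with $\mathrm{ARR}(x,t)=\rho(x,t)$ for all such $x$ and $t$. Similarly, if $\rho(x,t)\in\{-1,+1\}$ is arbitrarily defined for all integers $t\ge 0$ and $x$ with $x\sim t+1$, then there exists an odd initial configuration that results in a game with $\mathrm{ARR}(x,t)=\rho(x,t)$ for all such $x$ and $t$.
   Context: $\mathbb{N}_0$ is the set of non-negative integers. For integers $m,n$ write $m\sim n$ if $m-n$ is even. Propp machine on $\mathbb{Z}$: at each time $t\in\mathbb{N}_0$, each vertex $x\in\mathbb{Z}$ holds a number $f(x,t)\in\mathbb{N}_0$ of chips and an arrow $\mathrm{ARR}(x,t)\in\{-1,+1\}$ ($+1$ = right, $-1$ = left). The initial configuration (the values $f(x,0)$ and $\mathrm{ARR}(x,0)$, $x\in\mathbb{Z}$; infinitely many vertices may hold chips) determines all later configurations (the game) by $$f(x,t+1)=\tfrac12 f(x-1,t)+\tfrac12 f(x+1,t)+\tfrac12\mathrm{ARR}(x-1,t)\,(f(x-1,t)\bmod 2)-\tfrac12\mathrm{ARR}(x+1,t)\,(f(x+1,t)\bmod 2),$$ $$\mathrm{ARR}(x,t+1)=(-1)^{f(x,t)}\,\mathrm{ARR}(x,t).$$ That is, each vertex sends out all its chips one by one, alternately to its right and left neighbor, starting in the direction of its arrow, and the arrow flips after each chip sent. A configuration is even if no chip is at an odd position, and odd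 if no chip is at an even position (arrows are unrestricted). *)

theory Defs
  imports Complex_Main
begin

text \<open>A configuration consists of the chip counts and the arrows of all vertices; the arrow
  \<open>1\<close> points to the right and \<open>-1\<close> to the left.\<close>

type_synonym config = "(int \<Rightarrow> nat) \<times> (int \<Rightarrow> int)"

definition config :: "config \<Rightarrow> bool" where
  "config c \<longleftrightarrow> (\<forall>x. snd c x \<in> {-1, 1})"

definition even_config :: "config \<Rightarrow> bool" where
  "even_config c \<longleftrightarrow> config c \<and> (\<forall>x. odd x \<longrightarrow> fst c x = 0)"

definition odd_config :: "config \<Rightarrow> bool" where
  "odd_config c \<longleftrightarrow> config c \<and> (\<forall>x. even x \<longrightarrow> fst c x = 0)"

text \<open>For a valid configuration, the numerator in the chip count below is even and nonnegative,
  so that the integer division is exact and \<open>nat\<close> does not truncate;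
  see \<open>chips_Suc\<close> below.\<close>

definition propp_step :: "config \<Rightarrow> config" where
  "propp_step = (\<lambda>(f, A).
     (\<lambda>x. nat ((int (f (x - 1)) + int (f (x + 1))
                + A (x - 1) * int (f (x - 1) mod 2)
                - A (x + 1) * int (f (x + 1) mod 2)) div 2),
      \<lambda>x. (-1) ^ f x * A x))"

definition propp :: "config \<Rightarrow> nat \<Rightarrow> config" where
  "propp c t = (propp_step ^^ t) c"

definition chips :: "config \<Rightarrow> int \<Rightarrow> nat \<Rightarrow> nat" where
  "chips c x t = fst (propp c t) x"

definition ARR :: "config \<Rightarrow> int \<Rightarrow> nat \<Rightarrow> int" where
  "ARR c x t = snd (propp c t) x"

lemma propp_0: "chips c x 0 = fst c x" "ARR c x 0 = snd c x"
  by (simp_all add: chips_def ARR_def propp_def)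

lemma ARR_Suc: "ARR c x (Suc t) = (-1) ^ chips c x t * ARR c x t"
  by (simp add: chips_def ARR_def propp_def propp_step_def split_beta)

lemma ARR_values:
  assumes "config c"
  shows "ARR c x t \<in> {-1, 1}"
proof (induction t)
  case 0
  then show ?case using assms by (simp add: propp_0 config_def)
next
  case (Suc t)
  then show ?case by (cases "even (chips c x t)") (auto simp: ARR_Suc)
qed

lemma chips_Suc:
  assumes "config c"
  shows "real (chips c x (Suc t)) =
           1/2 * real (chips c (x - 1) t) + 1/2 * real (chips c (x + 1) t)
           + 1/2 * of_int (ARR c (x - 1) t) * real (chips c (x - 1) t mod 2)
           - 1/2 * of_int (ARR c (x + 1) t) * real (chips c (x + 1) t mod 2)"
proof -
  define m n a b where mn: "m = chips c (x - 1) t" "n = chips c (x + 1) t"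
    and ab: "a = ARR c (x - 1) t" "b = ARR c (x + 1) t"
  define s where "s = int m + int n + a * int (m mod 2) - b * int (n mod 2)"
  have ab': "a = -1 \<or> a = 1" "b = -1 \<or> b = 1"
    using ARR_values[OF assms] by (auto simp: ab)
  have step: "chips c x (Suc t) = nat (s div 2)"
    by (simp add: s_def mn ab chips_def ARR_def propp_def propp_step_def split_beta)
  have s: "even s \<and> s \<ge> 0"
    using ab' unfolding s_def by (elim disjE; simp; presburger)
  then have "2 * int (chips c x (Suc t)) = s"
    by (simp add: step)
  then have "2 * real (chips c x (Suc t)) = of_int s"
    by (metis of_int_mult of_int_numeral of_int_of_nat_eq)
  then show ?thesis
    by (simp add: s_def mn ab)
qed

end

theory Submission
  imports Defs
begin

text \<open>
  Fix a parity class of vertices; chips that start there are, at time \<open>t\<close>, in the class shifted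
  by \<open>t\<close>, and a vertex that is out of phase holds no chip and does not turn its arrow. So the arrow
  of \<open>x\<close> two time units after \<open>t\<close> differs from the one at \<open>t\<close> exactly if the chip count of \<open>x\<close>
  at \<open>t\<close> is odd. Prescribing the arrows amounts to prescribing the initial arrows and the parities
  of all chip counts at vertices in phase (\<open>parity_forcing\<close>).

  Parities are forced one time after the other. Adding \<open>2 ^ T * e x\<close> chips to each \<open>x\<close>
  changes no parity before time \<open>T\<close>, because the added chips are split evenly \<open>T\<close> times; at time
  \<open>T\<close> it adds the \<open>T\<close>-fold neighbour sum of \<open>e\<close> (\<open>propp_add_power2\<close>). Modulo 2 the
  neighbour sum is a surjective operator on functions on the integers, with an explicit right
  inverse (\<open>even_neighbour_sum_preimage\<close>), so that \<open>e\<close> can be chosen to correct all parities at time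
  \<open>T\<close> at once.

  The corrections for all \<open>T\<close> add up to a finite number of chips at each vertex because a preimage
  under the neighbour sum may be prescribed at two consecutive vertices. With zeros there, the
  correction for time \<open>T\<close> vanishes on \<open>{-T..<T}\<close> (\<open>funpow_neighbour_sum_preimage_window\<close>), and
  only finitely many corrections touch a given vertex. The limit agrees with the \<open>T\<close>-th
  approximation modulo \<open>2 ^ T\<close>, hence has the same parities before time \<open>T\<close>.
\<close>

section \<open>The neighbour sum modulo 2\<close>

definition neighbour_sum :: "(int \<Rightarrow> nat) \<Rightarrow> int \<Rightarrow> nat" where
  "neighbour_sum e x = e (x - 1) + e (x + 1)"

text \<open>The equation \<open>e (x - 1) + e (x + 1) = h x\<close> modulo 2 is solved outwards from the values
  0 at \<open>-1\<close> and \<open>0\<close>; the signs do not matter modulo 2, so the solution stays in the naturals.\<close>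

function neighbour_sum_preimage :: "(int \<Rightarrow> nat) \<Rightarrow> int \<Rightarrow> nat" where
  "neighbour_sum_preimage h x =
     (if x \<ge> 1 then h (x - 1) + neighbour_sum_preimage h (x - 2)
      else if x \<le> -2 then h (x + 1) + neighbour_sum_preimage h (x + 2)
      else 0)"
  by auto
termination
  \<comment> \<open>The centre of symmetry of the recursion is \<open>-1/2\<close>.\<close>
  by (relation "measure (\<lambda>(h, x). nat \<bar>2 * x + 1\<bar>)") auto

declare neighbour_sum_preimage.simps [simp del]

lemma even_neighbour_sum_preimage:
  "even (neighbour_sum (neighbour_sum_preimage h) x) \<longleftrightarrow> even (h x)"
proof (cases "x \<ge> 0")
  case True
  then have "neighbour_sum_preimage h (x + 1) = h x + neighbour_sum_preimage h (x - 1)"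
    by (subst neighbour_sum_preimage.simps) simp
  then show ?thesis
    by (auto simp: neighbour_sum_def)
next
  case False
  then have "neighbour_sum_preimage h (x - 1) = h x + neighbour_sum_preimage h (x + 1)"
    by (subst neighbour_sum_preimage.simps) (simp add: add.commute)
  then show ?thesis
    by (auto simp: neighbour_sum_def)
qed

lemma neighbour_sum_preimage_class:
  assumes "\<And>x. odd (x - (q + 1)) \<Longrightarrow> h x = 0" and "odd (x - q)"
  shows "neighbour_sum_preimage h x = 0"
  using assms
proof (induction h x rule: neighbour_sum_preimage.induct)
  case (1 h x)
  then show ?case
    by (subst neighbour_sum_preimage.simps) auto
qed

lemma neighbour_sum_preimage_window:
  assumes "\<And>x. - int T \<le> x \<Longrightarrow> x < int T \<Longrightarrow> h x = 0"
    and "- int (Suc T) \<le> x" and "x < int (Suc T)"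
  shows "neighbour_sum_preimage h x = 0"
  using assms
proof (induction h x rule: neighbour_sum_preimage.induct)
  case (1 h x)
  then show ?case
    by (subst neighbour_sum_preimage.simps) auto
qed

lemma even_funpow_neighbour_sum_cong:
  assumes "\<And>x. even (f x) \<longleftrightarrow> even (g x)"
  shows "even ((neighbour_sum ^^ n) f x) \<longleftrightarrow> even ((neighbour_sum ^^ n) g x)"
proof (induction n arbitrary: x)
  case 0
  then show ?case using assms by simp
next
  case (Suc n)
  then show ?case by (simp add: neighbour_sum_def)
qed

lemma even_funpow_neighbour_sum_preimage:
  "even ((neighbour_sum ^^ n) ((neighbour_sum_preimage ^^ n) h) x) \<longleftrightarrow> even (h x)"
proof (induction n arbitrary: x)
  case 0
  then show ?case by simp
next
  case (Suc n)
  have "even ((neighbour_sum ^^ n) (neighbour_sum (neighbour_sum_preimage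
            ((neighbour_sum_preimage ^^ n) h))) x)
        \<longleftrightarrow> even ((neighbour_sum ^^ n) ((neighbour_sum_preimage ^^ n) h) x)"
    by (intro even_funpow_neighbour_sum_cong even_neighbour_sum_preimage)
  with Suc show ?case
    by (simp add: funpow_swap1)
qed

lemma funpow_neighbour_sum_preimage_class:
  assumes "\<And>x. odd (x - q - int n) \<Longrightarrow> h x = 0" and "odd (x - q)"
  shows "(neighbour_sum_preimage ^^ n) h x = 0"
  using assms
proof (induction n arbitrary: q x)
  case 0
  then show ?case by simp
next
  case (Suc n)
  have "(neighbour_sum_preimage ^^ n) h y = 0" if "odd (y - (q + 1))" for y
    using Suc.IH[of "q + 1" y] Suc.prems(1) that by (simp add: algebra_simps)
  from neighbour_sum_preimage_class[OF this Suc.prems(2)] show ?case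
    by simp
qed

text \<open>Each application of the right inverse widens the interval of zeros by one vertex on either
  side. This is what keeps the total number of chips at each vertex finite.\<close>

lemma funpow_neighbour_sum_preimage_window:
  assumes "- int n \<le> x" and "x < int n"
  shows "(neighbour_sum_preimage ^^ n) h x = 0"
  using assms
proof (induction n arbitrary: x)
  case 0
  then show ?case by simp
next
  case (Suc n)
  then show ?case
    using neighbour_sum_preimage_window[of n "(neighbour_sum_preimage ^^ n) h" x] by simp
qed

section \<open>Adding multiples of a power of 2\<close>

lemma chips_Suc_int:
  assumes "config c"
  shows "2 * int (chips c x (Suc t)) =
           int (chips c (x - 1) t) + int (chips c (x + 1) t)
           + ARR c (x - 1) t * int (chips c (x - 1) t mod 2)
           - ARR c (x + 1) t * int (chips c (x + 1) t mod 2)"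
proof -
  have "real_of_int (2 * int (chips c x (Suc t))) = real_of_int (
           int (chips c (x - 1) t) + int (chips c (x + 1) t)
           + ARR c (x - 1) t * int (chips c (x - 1) t mod 2)
           - ARR c (x + 1) t * int (chips c (x + 1) t mod 2))"
    using chips_Suc[OF assms, of x t] by simp
  then show ?thesis by linarith
qed

text \<open>Before time \<open>T\<close> every vertex receives an even number of additional chips. They are sent in
  equal numbers to both sides and leave the arrow as it was, so the additional chips evolve
  linearly and the rest of the game does not notice them.\<close>

lemma propp_add_power2:
  assumes "config (f, A)" and "t \<le> T"
  shows "chips (\<lambda>x. f x + 2 ^ T * e x, A) x t
           = chips (f, A) x t + 2 ^ (T - t) * (neighbour_sum ^^ t) e x
       \<and> ARR (\<lambda>x. f x + 2 ^ T * e x, A) x t = ARR (f, A) x t"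
  using assms(2)
proof (induction t arbitrary: x)
  case 0
  then show ?case by (simp add: propp_0)
next
  case (Suc t)
  let ?c = "(f, A)" and ?d = "(\<lambda>x. f x + 2 ^ T * e x, A)"
  let ?g = "(neighbour_sum ^^ t) e"
  define P :: nat where "P = 2 ^ (T - Suc t)"
  have power: "2 ^ (T - t) = 2 * P"
    using Suc.prems unfolding P_def by (simp add: Suc_diff_Suc flip: power_Suc)
  have chips: "chips ?d y t = chips ?c y t + 2 * (P * ?g y)"
    and arr: "ARR ?d y t = ARR ?c y t" for y
    using Suc.IH[of y] Suc.prems by (simp_all add: power)
  have parity: "chips ?d y t mod 2 = chips ?c y t mod 2" for y
    by (simp add: chips)
  have d: "config ?d"
    using assms(1) by (simp add: config_def)
  have "2 * int (chips ?d x (Suc t)) = 2 * int (chips ?c x (Suc t))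
          + 2 * int (P * ?g (x - 1)) + 2 * int (P * ?g (x + 1))"
    unfolding chips_Suc_int[OF d] chips_Suc_int[OF assms(1)] parity arr
    by (simp add: chips)
  then have "chips ?d x (Suc t) = chips ?c x (Suc t) + P * ?g (x - 1) + P * ?g (x + 1)"
    by linarith
  moreover have "ARR ?d x (Suc t) = ARR ?c x (Suc t)"
    by (simp add: ARR_Suc arr chips power_add power_mult)
  ultimately show ?case
    by (simp add: P_def neighbour_sum_def[of ?g] distrib_left)
qed

section \<open>Forcing the parities of the chip counts\<close>

text \<open>The \<open>T\<close>-th approximation has the prescribed parities before time \<open>T\<close>. The next one adds
  \<open>2 ^ T\<close> times the preimage of the defect at time \<open>T\<close>.\<close>

definition parity_defect ::
    "(int \<Rightarrow> int) \<Rightarrow> int \<Rightarrow> (int \<Rightarrow> nat \<Rightarrow> bool) \<Rightarrow> (int \<Rightarrow> nat) \<Rightarrow> nat \<Rightarrow> int \<Rightarrow> nat" where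
  "parity_defect A q P f T y =
     of_bool (even (y - q - int T) \<and> (even (chips (f, A) y T) \<noteq> P y T))"

primrec parity_approx ::
    "(int \<Rightarrow> int) \<Rightarrow> int \<Rightarrow> (int \<Rightarrow> nat \<Rightarrow> bool) \<Rightarrow> nat \<Rightarrow> int \<Rightarrow> nat" where
  "parity_approx A q P 0 = (\<lambda>x. 0)"
| "parity_approx A q P (Suc T) =
     (\<lambda>x. parity_approx A q P T x
        + 2 ^ T * (neighbour_sum_preimage ^^ T) (parity_defect A q P (parity_approx A q P T) T) x)"

lemma parity_approx_class:
  assumes "odd (x - q)"
  shows "parity_approx A q P T x = 0"
proof (induction T)
  case 0
  then show ?case by simp
next
  case (Suc T)
  have "(neighbour_sum_preimage ^^ T) (parity_defect A q P (parity_approx A q P T) T) x = 0"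
    using assms by (intro funpow_neighbour_sum_preimage_class[of q])
      (simp_all add: parity_defect_def)
  with Suc show ?case by simp
qed

lemma parity_approx_parity:
  assumes "\<And>x. A x \<in> {-1, 1}" and "even (x - q - int t)" and "t < T"
  shows "even (chips (parity_approx A q P T, A) x t) \<longleftrightarrow> P x t"
  using assms(3)
proof (induction T)
  case 0
  then show ?case by simp
next
  case (Suc T)
  let ?f = "parity_approx A q P T"
  let ?h = "parity_defect A q P ?f T"
  let ?e = "(neighbour_sum_preimage ^^ T) ?h"
  have "config (?f, A)"
    using assms(1) by (simp add: config_def)
  then have chips: "chips (parity_approx A q P (Suc T), A) x t
      = chips (?f, A) x t + 2 ^ (T - t) * (neighbour_sum ^^ t) ?e x"
    using propp_add_power2[of ?f A t T ?e x] Suc.prems by simp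
  show ?case
  proof (cases "t = T")
    case True
    have "even ((neighbour_sum ^^ T) ?e x) \<longleftrightarrow> (even (chips (?f, A) x T) \<longleftrightarrow> P x T)"
      using assms(2) True
      by (simp add: even_funpow_neighbour_sum_preimage parity_defect_def)
    with chips True show ?thesis by auto
  next
    case False
    with Suc chips show ?thesis by simp
  qed
qed

lemma parity_approx_mod_power2:
  assumes "T \<le> T'"
  shows "\<exists>m. parity_approx A q P T' x = parity_approx A q P T x + 2 ^ T * m"
  using assms
proof (induction T' rule: dec_induct)
  case base
  show ?case by (rule exI[of _ 0]) simp
next
  case (step n)
  let ?e = "(neighbour_sum_preimage ^^ n) (parity_defect A q P (parity_approx A q P n) n) x"
  from step obtain m where m: "parity_approx A q P n x = parity_approx A q P T x + 2 ^ T * m"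
    by blast
  have "(2::nat) ^ n = 2 ^ T * 2 ^ (n - T)"
    using step by (simp flip: power_add)
  with m have "parity_approx A q P (Suc n) x
      = parity_approx A q P T x + 2 ^ T * (m + 2 ^ (n - T) * ?e)"
    by (simp add: algebra_simps)
  then show ?case by blast
qed

lemma parity_approx_stable:
  assumes "nat \<bar>x\<bar> < T" and "T \<le> T'"
  shows "parity_approx A q P T' x = parity_approx A q P T x"
  using assms(2)
proof (induction T' rule: dec_induct)
  case base
  show ?case by simp
next
  case (step n)
  have "- int n \<le> x" "x < int n"
    using assms(1) step by linarith+
  with step show ?case
    by (simp add: funpow_neighbour_sum_preimage_window)
qed

text \<open>The chip counts of the limit are the stable values of the approximations.\<close>

lemma parity_forcing:
  fixes A :: "int \<Rightarrow> int" and P :: "int \<Rightarrow> nat \<Rightarrow> bool"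
  assumes A: "\<And>x. A x \<in> {-1, 1}"
  obtains f where "\<And>x. odd (x - q) \<Longrightarrow> f x = 0"
    and "\<And>x t. even (x - q - int t) \<Longrightarrow> even (chips (f, A) x t) \<longleftrightarrow> P x t"
proof
  define f where "f x = parity_approx A q P (Suc (nat \<bar>x\<bar>)) x" for x
  show "f x = 0" if "odd (x - q)" for x
    unfolding f_def using that by (rule parity_approx_class)
  show "even (chips (f, A) x t) \<longleftrightarrow> P x t" if "even (x - q - int t)" for x t
  proof -
    let ?T = "Suc t"
    let ?g = "parity_approx A q P ?T"
    have "\<exists>m. f y = ?g y + 2 ^ ?T * m" for y
    proof -
      let ?S = "max ?T (Suc (nat \<bar>y\<bar>))"
      have "f y = parity_approx A q P ?S y"
        unfolding f_def by (rule parity_approx_stable[symmetric]) auto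
      then show ?thesis
        using parity_approx_mod_power2[of ?T ?S A q P y] by simp
    qed
    then obtain e where "\<And>y. f y = ?g y + 2 ^ ?T * e y"
      by metis
    then have f: "f = (\<lambda>y. ?g y + 2 ^ ?T * e y)"
      by blast
    have "config (?g, A)"
      using A by (simp add: config_def)
    then have "chips (f, A) x t = chips (?g, A) x t + 2 ^ (?T - t) * (neighbour_sum ^^ t) e x"
      unfolding f by (intro propp_add_power2[THEN conjunct1]) auto
    then have "even (chips (f, A) x t) \<longleftrightarrow> even (chips (?g, A) x t)"
      by simp
    also have "\<dots> \<longleftrightarrow> P x t"
      using A that by (intro parity_approx_parity) auto
    finally show ?thesis .
  qed
qed

section \<open>Forcing the arrows\<close>

lemma chips_out_of_phase:
  assumes "config c" and "\<And>x. odd (x - q) \<Longrightarrow> fst c x = 0" and "odd (x - q - int t)"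
  shows "chips c x t = 0"
  using assms(3)
proof (induction t arbitrary: x)
  case 0
  with assms(2) show ?case by (simp add: propp_0)
next
  case (Suc t)
  have "chips c (x - 1) t = 0" "chips c (x + 1) t = 0"
    using Suc.prems by (auto intro!: Suc.IH)
  with chips_Suc_int[OF assms(1), of x t] show ?case by simp
qed

text \<open>Vertices out of phase at time 0 hold no chip then and keep their arrow until time 1,
  which is why their initial arrow is \<open>\<rho> x 1\<close>.\<close>

lemma arrow_forcing:
  fixes \<rho> :: "int \<Rightarrow> nat \<Rightarrow> int"
  assumes \<rho>: "\<And>x t. even (x - q - int t) \<Longrightarrow> \<rho> x t \<in> {-1, 1}"
  shows "\<exists>c. config c \<and> (\<forall>x. odd (x - q) \<longrightarrow> fst c x = 0)
           \<and> (\<forall>x t. even (x - q - int t) \<longrightarrow> ARR c x t = \<rho> x t)"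
proof -
  define A where "A x = (if even (x - q) then \<rho> x 0 else \<rho> x 1)" for x
  have A: "A x \<in> {-1, 1}" for x
    using \<rho>[of x 0] \<rho>[of x 1] by (auto simp: A_def)
  obtain f where f_class: "\<And>x. odd (x - q) \<Longrightarrow> f x = 0"
    and parity: "\<And>x t. even (x - q - int t) \<Longrightarrow>
                   even (chips (f, A) x t) \<longleftrightarrow> \<rho> x t = \<rho> x (Suc (Suc t))"
    by (rule parity_forcing[where A = A and q = q
          and P = "\<lambda>x t. \<rho> x t = \<rho> x (Suc (Suc t))", OF A])
      (rule that)
  have c: "config (f, A)"
    using A by (simp add: config_def)
  have out_of_phase: "chips (f, A) x t = 0" if "odd (x - q - int t)" for x t
    using chips_out_of_phase[OF c _ that] f_class by simp
  have "ARR (f, A) x t = \<rho> x t" if "even (x - q - int t)" for x t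
    using that
  proof (induction t rule: induct_nat_012)
    case 0
    then show ?case by (simp add: propp_0 A_def)
  next
    case 1
    then have "chips (f, A) x 0 = 0"
      by (intro out_of_phase) simp
    with 1 show ?case by (simp add: propp_0 ARR_Suc A_def)
  next
    case (ge2 t)
    have phase: "even (x - q - int t)"
      using ge2.prems by simp
    then have "chips (f, A) x (Suc t) = 0"
      by (intro out_of_phase) simp
    then have "ARR (f, A) x (Suc (Suc t)) = (-1) ^ chips (f, A) x t * \<rho> x t"
      using ge2.IH(1) phase by (simp add: ARR_Suc)
    with parity[OF phase] \<rho>[OF phase] \<rho>[OF ge2.prems] show ?case
      by (cases "even (chips (f, A) x t)") auto
  qed
  with c f_class show ?thesis
    by (intro exI[of _ "(f, A)"]) simp
qed

theorem theorem2:
  shows "(\<forall>\<rho> :: int \<Rightarrow> nat \<Rightarrow> int.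
            (\<forall>x t. even (x - int t) \<longrightarrow> \<rho> x t \<in> {-1, 1}) \<longrightarrow>
            (\<exists>c. even_config c \<and>
                 (\<forall>x t. even (x - int t) \<longrightarrow> ARR c x t = \<rho> x t)))
       \<and> (\<forall>\<rho> :: int \<Rightarrow> nat \<Rightarrow> int.
            (\<forall>x t. even (x - (int t + 1)) \<longrightarrow> \<rho> x t \<in> {-1, 1}) \<longrightarrow>
            (\<exists>c. odd_config c \<and>
                 (\<forall>x t. even (x - (int t + 1)) \<longrightarrow> ARR c x t = \<rho> x t)))"
proof (intro conjI allI impI)
  fix \<rho> :: "int \<Rightarrow> nat \<Rightarrow> int"
  assume "\<forall>x t. even (x - int t) \<longrightarrow> \<rho> x t \<in> {-1, 1}"
  then have "\<rho> x t \<in> {-1, 1}" if "even (x - 0 - int t)" for x t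
    using that by simp
  from arrow_forcing[where \<rho> = \<rho> and q = 0, OF this]
  show "\<exists>c. even_config c \<and> (\<forall>x t. even (x - int t) \<longrightarrow> ARR c x t = \<rho> x t)"
    by (simp add: even_config_def)
next
  have shift: "x - (int t + 1) = x - 1 - int t" for x t
    by simp
  fix \<rho> :: "int \<Rightarrow> nat \<Rightarrow> int"
  assume "\<forall>x t. even (x - (int t + 1)) \<longrightarrow> \<rho> x t \<in> {-1, 1}"
  then have "\<rho> x t \<in> {-1, 1}" if "even (x - 1 - int t)" for x t
    using that unfolding shift by blast
  from arrow_forcing[where \<rho> = \<rho> and q = 1, OF this]
  show "\<exists>c. odd_config c \<and> (\<forall>x t. even (x - (int t + 1)) \<longrightarrow> ARR c x t = \<rho> x t)"
    unfolding shift by (simp add: odd_config_def)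
qed

end
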